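(* Let $N=\sum_i\delta_{a_i}$ be a randomly scaled scale-decorated Poisson point process (SScDPPP) on $(0,\infty]$. Then the point process $\sum_i\delta_{\log a_i}$ obtained by taking the logarithm of each atom is a randomly shifted decorated Poisson point process (SDPPP) on $(-\infty,\infty]$. Conversely, if $T=\sum_i\delta_{b_i}$ is an SDPPP on $(-\infty,\infty]$, then the point process $\sum_i\delta_{\exp(b_i)}$ obtained by taking the exponential of each atom is an SScDPPP on $(0,\infty]$.
   Context: A point process on $(0,\infty]$ (respectively on $(-\infty,\infty]$) is a random Radon (locally finite) point measure on that space with no mass at $\infty$; compact subsets of $(0,\infty]$ are bounded away from $0$ and compact subsets of $(-\infty,\infty]$ are bounded away from $-\infty$. For $b>0$, $\mathbf{S}_b\sum_i\delta_{u_i}=\sum_i\delta_{bu_i}$; for $x\in\mathbb{R}$, $\theta_x\sum_i\delta_{p_i}=\sum_i\delta_{x+p_i}$. SScDPPP on $(0,\infty]$: a point process $M$ on $(0,\infty]$ with $M\overset{d}{=}\mathbf{S}_W\sum_{i\ge1}\mathbf{S}_{\lambda_i}\mathcal{P}_i$, where $\sum_{i\ge1}\delta_{\lambda_i}$ is a Poisson random measure on $(0,\infty)$ with some intensity measure $m$, $(\mathcal{P}_i)_{i\ge1}$ are i.i.d. copies of some point process $\mathcal{P}$ on $(0,\infty]$ independent of the Poisson random measure, and $W$ is a positive random variable independent of everything else. SDPPP on $(-\infty,\infty]$: a point process $T$ on $(-\infty,\infty]$ with $T\overset{d}{=}\theta_U\sum_{i\ge1}\theta_{\lambda_i}\mathcal{P}_i$,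 where $\sum_{i\ge1}\delta_{\lambda_i}$ is a Poisson random measure on $\mathbb{R}$ with some intensity measure $m$, $(\mathcal{P}_i)_{i\ge1}$ are i.i.d. copies of some point process $\mathcal{P}$ on $(-\infty,\infty]$ independent of the Poisson random measure, and $U$ is a real random variable independent of everything else. *)

theory Defs
  imports "HOL-Probability.Probability"
begin

section \<open>Random measures and point processes\<close>

text \<open>The set of all measures on \<open>E\<close>, with the \<open>\<sigma>\<close>-algebra generated by the evaluations
  \<open>\<mu> \<mapsto> \<mu> A\<close>. It carries the laws of all random measures on \<open>E\<close>; point processes are those
  random measures whose values are Radon point measures.\<close>

definition measure_algebra :: "'e measure \<Rightarrow> 'e measure measure" where
  "measure_algebra E =
     (SUP A \<in> sets E. vimage_algebra {\<mu>. sets \<mu> = sets E} (\<lambda>\<mu>. emeasure \<mu> A) borel)"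

definition eq_in_distr :: "'a measure \<Rightarrow> ('a \<Rightarrow> 'c) \<Rightarrow> 'b measure \<Rightarrow> ('b \<Rightarrow> 'c) \<Rightarrow> 'c measure \<Rightarrow> bool" where
  "eq_in_distr \<Omega> X \<Omega>' Y N \<longleftrightarrow>
     X \<in> \<Omega> \<rightarrow>\<^sub>M N \<and> Y \<in> \<Omega>' \<rightarrow>\<^sub>M N \<and> distr \<Omega> N X = distr \<Omega>' N Y"

abbreviation gen_sigma :: "'a measure \<Rightarrow> ('a \<Rightarrow> 'b) \<Rightarrow> 'b measure \<Rightarrow> 'a set set" where
  "gen_sigma \<Omega> X N \<equiv> sets (vimage_algebra (space \<Omega>) X N)"

text \<open>The measure \<open>\<Sum>i\<in>I. \<delta> (u i)\<close> is the image under \<open>u\<close> of the counting measure on \<open>I\<close>.\<close>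

definition dirac_sum :: "'e measure \<Rightarrow> nat set \<Rightarrow> (nat \<Rightarrow> 'e) \<Rightarrow> 'e measure" where
  "dirac_sum E I u = distr (count_space I) E u"

definition measure_sum :: "'e measure \<Rightarrow> nat set \<Rightarrow> (nat \<Rightarrow> 'e measure) \<Rightarrow> 'e measure" where
  "measure_sum E I \<mu> =
     measure_of (space E) (sets E) (\<lambda>A. \<integral>\<^sup>+ i. emeasure (\<mu> i) A \<partial>count_space I)"

text \<open>Here \<open>S\<close> is \<open>(0,\<infinity>]\<close> or \<open>(-\<infinity>,\<infinity>]\<close>, as a subspace of the extended reals.\<close>

abbreviation Bor :: "ereal set \<Rightarrow> ereal measure" where
  "Bor S \<equiv> restrict_space borel S"

definition point_measures :: "ereal set \<Rightarrow> ereal measure set" where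
  "point_measures S = {\<mu>. (\<exists>I. \<exists>u \<in> I \<rightarrow> S. \<mu> = dirac_sum (Bor S) I u) \<and>
     (\<forall>C. compact C \<and> C \<subseteq> S \<longrightarrow> emeasure \<mu> C < \<infinity>) \<and> emeasure \<mu> {\<infinity>} = 0}"

definition point_process :: "ereal set \<Rightarrow> 'a measure \<Rightarrow> ('a \<Rightarrow> ereal measure) \<Rightarrow> bool" where
  "point_process S \<Omega> N \<longleftrightarrow> prob_space \<Omega> \<and> N \<in> \<Omega> \<rightarrow>\<^sub>M measure_algebra (Bor S) \<and>
     (\<forall>\<omega> \<in> space \<Omega>. N \<omega> \<in> point_measures S)"

text \<open>Moving every atom of a point measure by \<open>f\<close>, i.e. \<open>\<Sum>i. \<delta> (u i) \<mapsto> \<Sum>i. \<delta> (f (u i))\<close>, is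
  taking the image measure:\<close>

definition map_atoms :: "ereal set \<Rightarrow> (ereal \<Rightarrow> ereal) \<Rightarrow> ereal measure \<Rightarrow> ereal measure" where
  "map_atoms S f \<mu> = distr \<mu> (Bor S) f"

lemma map_atoms_dirac_sum:
  assumes "u \<in> I \<rightarrow> S" and "f \<in> Bor S \<rightarrow>\<^sub>M Bor S'"
  shows "map_atoms S' f (dirac_sum (Bor S) I u) = dirac_sum (Bor S') I (\<lambda>i. f (u i))"
  using assms
  by (simp add: map_atoms_def dirac_sum_def distr_distr comp_def space_restrict_space)

section \<open>Poisson random measures\<close>

text \<open>The Poisson weights are written out because \<open>poisson_pmf\<close> is only specified for
  strictly positive rates, whereas \<open>m A = 0\<close> has to be covered.\<close>

definition poisson_random_measure :: "'a measure \<Rightarrow> 'e measure \<Rightarrow> ('a \<Rightarrow> 'e measure) \<Rightarrow> bool" where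
  "poisson_random_measure \<Omega> m Z \<longleftrightarrow> prob_space \<Omega> \<and> sigma_finite_measure m \<and>
     Z \<in> \<Omega> \<rightarrow>\<^sub>M measure_algebra m \<and>
     (\<forall>A \<in> sets m. emeasure m A < \<infinity> \<longrightarrow> (\<forall>k::nat.
        measure \<Omega> {\<omega> \<in> space \<Omega>. emeasure (Z \<omega>) A = of_nat k} =
          measure m A ^ k / fact k * exp (- measure m A))) \<and>
     (\<forall>A \<in> sets m. emeasure m A = \<infinity> \<longrightarrow> (AE \<omega> in \<Omega>. emeasure (Z \<omega>) A = \<infinity>)) \<and>
     (\<forall>A :: nat \<Rightarrow> 'e set. range A \<subseteq> sets m \<and> disjoint_family A \<longrightarrow>
        prob_space.indep_vars \<Omega> (\<lambda>_. borel) (\<lambda>i \<omega>. emeasure (Z \<omega>) (A i)) UNIV)"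

section \<open>Randomly transformed decorated Poisson point processes\<close>

text \<open>The group \<open>G\<close> of reals acts on \<open>S\<close> by \<open>act\<close>; it is \<open>(0,\<infinity>)\<close> acting on \<open>(0,\<infinity>]\<close> by
  multiplication, or the additive group of all reals acting on \<open>(-\<infinity>,\<infinity>]\<close> by translation.

  The atoms of the Poisson random measure are enumerated as \<open>lam 0, lam 1, \<dots>\<close>, and only those
  with index below the random number \<open>K\<close>, which may be infinite, count. Measures with finitely
  many atoms, or none, are thereby included. Independence of the Poisson random measure refers
  to this enumeration.\<close>

definition atom_index :: "enat \<Rightarrow> nat set" where
  "atom_index k = {i. enat i < k}"

definition decorated_sum ::
  "ereal set \<Rightarrow> (real \<Rightarrow> ereal \<Rightarrow> ereal) \<Rightarrow> ('a \<Rightarrow> enat) \<Rightarrow> (nat \<Rightarrow> 'a \<Rightarrow> real) \<Rightarrow>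
   (nat \<Rightarrow> 'a \<Rightarrow> ereal measure) \<Rightarrow> ('a \<Rightarrow> real) \<Rightarrow> 'a \<Rightarrow> ereal measure" where
  "decorated_sum S act K lam P W \<omega> =
     map_atoms S (act (W \<omega>))
       (measure_sum (Bor S) (atom_index (K \<omega>)) (\<lambda>i. map_atoms S (act (lam i \<omega>)) (P i \<omega>)))"

definition decoration_data ::
  "ereal set \<Rightarrow> real set \<Rightarrow> 'a measure \<Rightarrow> ('a \<Rightarrow> enat) \<Rightarrow> (nat \<Rightarrow> 'a \<Rightarrow> real) \<Rightarrow>
   (nat \<Rightarrow> 'a \<Rightarrow> ereal measure) \<Rightarrow> ('a \<Rightarrow> real) \<Rightarrow> bool" where
  "decoration_data S G \<Omega> K lam P W \<longleftrightarrow>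
     (let A = restrict_space borel G;
          atoms_alg = count_space UNIV \<Otimes>\<^sub>M (\<Pi>\<^sub>M i \<in> UNIV. A);
          decor_alg = \<Pi>\<^sub>M i \<in> UNIV. measure_algebra (Bor S);
          atoms = (\<lambda>\<omega>. (K \<omega>, \<lambda>i. lam i \<omega>));
          decor = (\<lambda>\<omega> i. P i \<omega>)
      in prob_space \<Omega> \<and>
         K \<in> \<Omega> \<rightarrow>\<^sub>M count_space UNIV \<and> (\<forall>i. lam i \<in> \<Omega> \<rightarrow>\<^sub>M A) \<and> W \<in> \<Omega> \<rightarrow>\<^sub>M A \<and>
         (\<exists>m. sets m = sets A \<and>
            poisson_random_measure \<Omega> m (\<lambda>\<omega>. dirac_sum A (atom_index (K \<omega>)) (\<lambda>i. lam i \<omega>))) \<and>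
         (\<forall>i. point_process S \<Omega> (P i)) \<and>
         (\<forall>i. eq_in_distr \<Omega> (P i) \<Omega> (P 0) (measure_algebra (Bor S))) \<and>
         prob_space.indep_vars \<Omega> (\<lambda>_. measure_algebra (Bor S)) P UNIV \<and>
         prob_space.indep_set \<Omega> (gen_sigma \<Omega> atoms atoms_alg) (gen_sigma \<Omega> decor decor_alg) \<and>
         prob_space.indep_set \<Omega> (gen_sigma \<Omega> W A)
           (gen_sigma \<Omega> (\<lambda>\<omega>. (atoms \<omega>, decor \<omega>)) (atoms_alg \<Otimes>\<^sub>M decor_alg)))"

text \<open>The representation may live on a probability space different from that of \<open>N\<close>. HOL cannot
  quantify over its underlying type, so that type is fixed to the value type of the triple
  (enumerated atoms, decorations, \<open>W\<close>). This is no restriction: the conditions only involve the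
  joint law of the triple, so any representation can be transported there.\<close>

definition decorated_poisson_process ::
  "ereal set \<Rightarrow> real set \<Rightarrow> (real \<Rightarrow> ereal \<Rightarrow> ereal) \<Rightarrow> 'a measure \<Rightarrow> ('a \<Rightarrow> ereal measure) \<Rightarrow> bool" where
  "decorated_poisson_process S G act \<Omega> N \<longleftrightarrow> point_process S \<Omega> N \<and>
     (\<exists>(\<Omega>' :: ((enat \<times> (nat \<Rightarrow> real)) \<times> (nat \<Rightarrow> ereal measure) \<times> real) measure) K lam P W.
        decoration_data S G \<Omega>' K lam P W \<and>
        eq_in_distr \<Omega> N \<Omega>' (decorated_sum S act K lam P W) (measure_algebra (Bor S)))"

definition SScDPPP :: "'a measure \<Rightarrow> ('a \<Rightarrow> ereal measure) \<Rightarrow> bool" where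
  "SScDPPP = decorated_poisson_process {0<..} {0<..} (\<lambda>b x. ereal b * x)"

definition SDPPP :: "'a measure \<Rightarrow> ('a \<Rightarrow> ereal measure) \<Rightarrow> bool" where
  "SDPPP = decorated_poisson_process {-\<infinity><..} UNIV (\<lambda>b x. ereal b + x)"

section \<open>Logarithm and exponential of the atoms\<close>

text \<open>The values at \<open>-\<infinity>\<close> are irrelevant, since it lies outside both state spaces.\<close>

definition ereal_ln :: "ereal \<Rightarrow> ereal" where
  "ereal_ln x = (case x of ereal r \<Rightarrow> ereal (ln r) | PInfty \<Rightarrow> \<infinity> | MInfty \<Rightarrow> -\<infinity>)"

definition ereal_exp :: "ereal \<Rightarrow> ereal" where
  "ereal_exp x = (case x of ereal r \<Rightarrow> ereal (exp r) | PInfty \<Rightarrow> \<infinity> | MInfty \<Rightarrow> 0)"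

definition log_atoms :: "ereal measure \<Rightarrow> ereal measure" where
  "log_atoms = map_atoms {-\<infinity><..} ereal_ln"

definition exp_atoms :: "ereal measure \<Rightarrow> ereal measure" where
  "exp_atoms = map_atoms {0<..} ereal_exp"

end

theory Submission
  imports Defs
begin

text \<open>The logarithm is a homeomorphism \<open>(0,\<infinity>] \<rightarrow> (-\<infinity>,\<infinity>]\<close> that intertwines scaling by \<open>b\<close> with
  translation by \<open>ln b\<close>. Hence a representation of \<open>N\<close> by \<open>(\<lambda>\<^sub>i)\<close>, \<open>(P\<^sub>i)\<close>, \<open>W\<close> is transported,
  on the same probability space, to one by \<open>(ln \<lambda>\<^sub>i)\<close>, \<open>(log_atoms P\<^sub>i)\<close>, \<open>ln W\<close>: image measures
  preserve Poisson random measures, and measurable functions preserve independence and equality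
  in law. The argument only uses that the homeomorphism is equivariant, so it applies to
  \<open>exp\<close> as well.\<close>

section \<open>Random measures\<close>

lemma space_measure_algebra: "space (measure_algebra E) = {\<mu>. sets \<mu> = sets E}"
  unfolding measure_algebra_def space_Sup_eq_UN by auto

lemma measure_algebra_cong: "sets E = sets E' \<Longrightarrow> measure_algebra E = measure_algebra E'"
  by (simp add: measure_algebra_def)

text \<open>A supremum of initial sigma-algebras is again initial, here for the family of all
  evaluations.\<close>

lemma measurable_measure_algebraI:
  assumes "\<And>\<omega>. \<omega> \<in> space M \<Longrightarrow> sets (X \<omega>) = sets E"
    and "\<And>A. A \<in> sets E \<Longrightarrow> (\<lambda>\<omega>. emeasure (X \<omega>) A) \<in> borel_measurable M"
  shows "X \<in> M \<rightarrow>\<^sub>M measure_algebra E"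
  unfolding measure_algebra_def
  by (rule measurable_SUP2) (use assms in \<open>auto intro!: measurable_vimage_algebra2\<close>)

lemma measurable_emeasure_measure_algebra:
  assumes "A \<in> sets E"
  shows "(\<lambda>\<mu>. emeasure \<mu> A) \<in> borel_measurable (measure_algebra E)"
  unfolding measure_algebra_def
  by (rule measurable_SUP1[OF assms]) (auto intro!: measurable_vimage_algebra1)

text \<open>Evaluating the image measure at \<open>A\<close> is evaluating the original at the
  preimage of \<open>A\<close>, which is again one of the generating maps.\<close>

lemma measurable_distr_measure_algebra:
  assumes f: "f \<in> E \<rightarrow>\<^sub>M E'"
  shows "(\<lambda>\<mu>. distr \<mu> E' f) \<in> measure_algebra E \<rightarrow>\<^sub>M measure_algebra E'"
proof (rule measurable_measure_algebraI)
  fix A assume A: "A \<in> sets E'"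
  have "(\<lambda>\<mu>. emeasure \<mu> (f -` A \<inter> space E)) \<in> borel_measurable (measure_algebra E)"
    by (rule measurable_emeasure_measure_algebra) (rule measurable_sets[OF f A])
  then show "(\<lambda>\<mu>. emeasure (distr \<mu> E' f) A) \<in> borel_measurable (measure_algebra E)"
  \<comment> \<open>The two evaluations are only compared on the space of
    \<open>measure_algebra E\<close>, where \<open>f\<close> is measurable on \<mu> and
    \<open>space \<mu>\<close> equals \<open>space E\<close>.\<close>
  proof (rule measurable_cong[THEN iffD1, rotated])
    fix \<mu> assume "\<mu> \<in> space (measure_algebra E)"
    then have s: "sets \<mu> = sets E"
      by (simp add: space_measure_algebra)
    then have "f \<in> \<mu> \<rightarrow>\<^sub>M E'"
      using f by (simp cong: measurable_cong_sets)
    then show "emeasure \<mu> (f -` A \<inter> space E) = emeasure (distr \<mu> E' f) A"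
      using A sets_eq_imp_space_eq[OF s] by (simp add: emeasure_distr)
  qed
qed simp

section \<open>Superposition of measures\<close>

lemma sets_measure_sum [simp]: "sets (measure_sum E I \<mu>) = sets E"
  by (simp add: measure_sum_def)

text \<open>\<open>measure_of\<close> gives the intended values only once the set function is known
  to be countably additive. That follows by exchanging the series over the disjoint sets with the
  integral over \<open>I\<close>.\<close>

lemma emeasure_measure_sum:
  assumes s: "\<And>i. i \<in> I \<Longrightarrow> sets (\<mu> i) = sets E" and A: "A \<in> sets E"
  shows "emeasure (measure_sum E I \<mu>) A = (\<integral>\<^sup>+ i. emeasure (\<mu> i) A \<partial>count_space I)"
  unfolding measure_sum_def
proof (rule emeasure_measure_of[OF refl])
  show "countably_additive (sets (measure_of (space E) (sets E)
      (\<lambda>A. \<integral>\<^sup>+ i. emeasure (\<mu> i) A \<partial>count_space I))) (\<lambda>A. \<integral>\<^sup>+ i. emeasure (\<mu> i) A \<partial>count_space I)"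
  proof (rule countably_additiveI)
    fix B :: "nat \<Rightarrow> _"
    assume B: "range B \<subseteq> sets (measure_of (space E) (sets E)
        (\<lambda>A. \<integral>\<^sup>+ i. emeasure (\<mu> i) A \<partial>count_space I))" "disjoint_family B"
    have "(\<Sum>n. \<integral>\<^sup>+ i. emeasure (\<mu> i) (B n) \<partial>count_space I) =
        (\<integral>\<^sup>+ i. (\<Sum>n. emeasure (\<mu> i) (B n)) \<partial>count_space I)"
      by (rule nn_integral_suminf[symmetric]) simp
    also have "\<dots> = (\<integral>\<^sup>+ i. emeasure (\<mu> i) (\<Union>n. B n) \<partial>count_space I)"
      using B s by (intro nn_integral_cong suminf_emeasure) auto
    finally show "(\<Sum>n. \<integral>\<^sup>+ i. emeasure (\<mu> i) (B n) \<partial>count_space I) =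
        (\<integral>\<^sup>+ i. emeasure (\<mu> i) (\<Union>n. B n) \<partial>count_space I)" .
  qed
qed (use A sets.sets_into_space in \<open>auto simp: positive_def\<close>)

text \<open>Evaluated at \<open>A\<close>, both sides add up the masses that the summands give to
  the preimage of \<open>A\<close>.\<close>

lemma distr_measure_sum:
  assumes s: "\<And>i. i \<in> I \<Longrightarrow> sets (\<mu> i) = sets E" and f: "f \<in> E \<rightarrow>\<^sub>M E'"
  shows "distr (measure_sum E I \<mu>) E' f = measure_sum E' I (\<lambda>i. distr (\<mu> i) E' f)"
proof (rule measure_eqI)
  fix A assume "A \<in> sets (distr (measure_sum E I \<mu>) E' f)"
  then have A: "A \<in> sets E'" by simp
  have f': "f \<in> measure_sum E I \<mu> \<rightarrow>\<^sub>M E'"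
    using f by (simp cong: measurable_cong_sets)
  have sp: "space (measure_sum E I \<mu>) = space E"
    by (rule sets_eq_imp_space_eq) simp
  have "emeasure (distr (measure_sum E I \<mu>) E' f) A = emeasure (measure_sum E I \<mu>) (f -` A \<inter> space E)"
    using A f' by (simp add: emeasure_distr sp)
  also have "\<dots> = (\<integral>\<^sup>+ i. emeasure (\<mu> i) (f -` A \<inter> space E) \<partial>count_space I)"
    by (rule emeasure_measure_sum[OF s measurable_sets[OF f A]])
  also have "\<dots> = (\<integral>\<^sup>+ i. emeasure (distr (\<mu> i) E' f) A \<partial>count_space I)"
  proof (rule nn_integral_cong)
    fix i assume "i \<in> space (count_space I)"
    then have "sets (\<mu> i) = sets E" by (simp add: s)
    moreover from this have "f \<in> \<mu> i \<rightarrow>\<^sub>M E'"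
      using f by (simp cong: measurable_cong_sets)
    ultimately show "emeasure (\<mu> i) (f -` A \<inter> space E) = emeasure (distr (\<mu> i) E' f) A"
      using A sets_eq_imp_space_eq[of "\<mu> i" E] by (simp add: emeasure_distr)
  qed
  also have "\<dots> = emeasure (measure_sum E' I (\<lambda>i. distr (\<mu> i) E' f)) A"
    by (rule emeasure_measure_sum[symmetric]) (use A in auto)
  finally show "emeasure (distr (measure_sum E I \<mu>) E' f) A =
      emeasure (measure_sum E' I (\<lambda>i. distr (\<mu> i) E' f)) A" .
qed simp

text \<open>Analogue of \<open>map_atoms_dirac_sum\<close> for arbitrary spaces, meant for the
  real-valued Poisson atoms.\<close>

lemma distr_dirac_sum:
  assumes "u \<in> I \<rightarrow> space E" and "f \<in> E \<rightarrow>\<^sub>M E'"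
  shows "distr (dirac_sum E I u) E' f = dirac_sum E' I (\<lambda>i. f (u i))"
  using assms by (simp add: dirac_sum_def distr_distr comp_def)

section \<open>Equality in law and independence under measurable functions\<close>

lemma eq_in_distr_compose:
  assumes "eq_in_distr \<Omega> X \<Omega>' Y A" and f: "f \<in> A \<rightarrow>\<^sub>M B"
  shows "eq_in_distr \<Omega> (\<lambda>\<omega>. f (X \<omega>)) \<Omega>' (\<lambda>\<omega>. f (Y \<omega>)) B"
proof -
  from assms(1) have X: "X \<in> \<Omega> \<rightarrow>\<^sub>M A" and Y: "Y \<in> \<Omega>' \<rightarrow>\<^sub>M A" and eq: "distr \<Omega> A X = distr \<Omega>' A Y"
    by (auto simp: eq_in_distr_def)
  have "distr \<Omega> B (\<lambda>\<omega>. f (X \<omega>)) = distr (distr \<Omega> A X) B f"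
    using X f by (simp add: distr_distr comp_def)
  also have "\<dots> = distr \<Omega>' B (\<lambda>\<omega>. f (Y \<omega>))"
    unfolding eq using Y f by (simp add: distr_distr comp_def)
  finally show ?thesis
    using measurable_compose[OF X f] measurable_compose[OF Y f] by (simp add: eq_in_distr_def)
qed

text \<open>\<open>X\<close> is measurable for its own generated sigma-algebra, hence so is its
  composition with \<open>f\<close>, which generates the smallest such sigma-algebra. With
  \<open>indep_set_mono\<close> this passes independence on to functions of the variables.\<close>

lemma gen_sigma_compose_subset:
  assumes X: "X \<in> \<Omega> \<rightarrow>\<^sub>M A" and f: "f \<in> A \<rightarrow>\<^sub>M B"
  shows "gen_sigma \<Omega> (\<lambda>\<omega>. f (X \<omega>)) B \<subseteq> gen_sigma \<Omega> X A"
proof (rule sets_image_in_sets)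
  have "X \<in> vimage_algebra (space \<Omega>) X A \<rightarrow>\<^sub>M A"
    using measurable_space[OF X] by (intro measurable_vimage_algebra1) auto
  then show "(\<lambda>\<omega>. f (X \<omega>)) \<in> vimage_algebra (space \<Omega>) X A \<rightarrow>\<^sub>M B"
    by (rule measurable_compose[OF _ f])
qed simp

lemma (in prob_space) indep_set_mono:
  assumes "indep_set A B" and "A' \<subseteq> A" and "B' \<subseteq> B"
  shows "indep_set A' B'"
  using assms unfolding indep_sets2_eq by blast

text \<open>Independence is a statement about events intersected with the sample space. The version
  is needed because the formulas for image measures hold only at sample points of that
  space.\<close>

lemma (in prob_space) indep_vars_cong_space:
  assumes "\<And>i \<omega>. i \<in> I \<Longrightarrow> \<omega> \<in> space M \<Longrightarrow> X i \<omega> = Y i \<omega>"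
  shows "indep_vars N X I \<longleftrightarrow> indep_vars N Y I"
proof -
  have "X i -` A \<inter> space M = Y i -` A \<inter> space M" if "i \<in> I" for i A
    using assms[OF that] by auto
  then have "indep_sets (\<lambda>i. {X i -` A \<inter> space M | A. A \<in> sets (N i)}) I \<longleftrightarrow>
      indep_sets (\<lambda>i. {Y i -` A \<inter> space M | A. A \<in> sets (N i)}) I"
    by (intro indep_sets_cong) auto
  moreover have "random_variable (N i) (X i) \<longleftrightarrow> random_variable (N i) (Y i)" if "i \<in> I" for i
    using assms[OF that] by (rule measurable_cong)
  ultimately show ?thesis
    unfolding indep_vars_def2 by auto
qed

section \<open>Poisson random measures under maps\<close>

lemma poisson_random_measure_cong:
  assumes prm: "poisson_random_measure \<Omega> m Z" and eq: "\<And>\<omega>. \<omega> \<in> space \<Omega> \<Longrightarrow> Z \<omega> = Z' \<omega>"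
  shows "poisson_random_measure \<Omega> m Z'"
proof -
  have \<Omega>: "prob_space \<Omega>" using prm by (simp add: poisson_random_measure_def)
  interpret prob_space \<Omega> by (fact \<Omega>)
  have "{\<omega> \<in> space \<Omega>. emeasure (Z \<omega>) A = c} = {\<omega> \<in> space \<Omega>. emeasure (Z' \<omega>) A = c}" for A c
    using eq by auto
  moreover have "Z \<in> \<Omega> \<rightarrow>\<^sub>M measure_algebra m \<longleftrightarrow> Z' \<in> \<Omega> \<rightarrow>\<^sub>M measure_algebra m"
    by (rule measurable_cong) (rule eq)
  moreover have "(AE \<omega> in \<Omega>. emeasure (Z \<omega>) A = \<infinity>) \<longleftrightarrow> (AE \<omega> in \<Omega>. emeasure (Z' \<omega>) A = \<infinity>)" for A
    by (rule AE_cong) (simp add: eq)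
  moreover have "indep_vars (\<lambda>_. borel) (\<lambda>i \<omega>. emeasure (Z \<omega>) (A i)) UNIV \<longleftrightarrow>
      indep_vars (\<lambda>_. borel) (\<lambda>i \<omega>. emeasure (Z' \<omega>) (A i)) UNIV" for A :: "nat \<Rightarrow> _"
    by (rule indep_vars_cong_space) (simp add: eq)
  ultimately show ?thesis
    using prm unfolding poisson_random_measure_def by simp
qed

text \<open>The mapping theorem: the image random measure has at \<open>B\<close> the value of
  \<open>Z\<close> at the preimage of \<open>B\<close>, so each clause is the old one at preimages.
  The left inverse \<open>k\<close> secures sigma-finiteness of the image intensity, which can fail
  for a general measurable map.\<close>

lemma poisson_random_measure_distr:
  assumes prm: "poisson_random_measure \<Omega> m Z"
    and h: "h \<in> m \<rightarrow>\<^sub>M A'" and k: "k \<in> A' \<rightarrow>\<^sub>M m" and kh: "\<And>x. x \<in> space m \<Longrightarrow> k (h x) = x"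
  shows "poisson_random_measure \<Omega> (distr m A' h) (\<lambda>\<omega>. distr (Z \<omega>) A' h)"
proof -
  have \<Omega>: "prob_space \<Omega>" and sf: "sigma_finite_measure m" and Z: "Z \<in> \<Omega> \<rightarrow>\<^sub>M measure_algebra m"
    and law: "\<And>A j. A \<in> sets m \<Longrightarrow> emeasure m A < \<infinity> \<Longrightarrow>
        measure \<Omega> {\<omega> \<in> space \<Omega>. emeasure (Z \<omega>) A = of_nat j} = measure m A ^ j / fact j * exp (- measure m A)"
    and inf: "\<And>A. A \<in> sets m \<Longrightarrow> emeasure m A = \<infinity> \<Longrightarrow> AE \<omega> in \<Omega>. emeasure (Z \<omega>) A = \<infinity>"
    and ind: "\<And>A :: nat \<Rightarrow> _ set. range A \<subseteq> sets m \<Longrightarrow> disjoint_family A \<Longrightarrow>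
        prob_space.indep_vars \<Omega> (\<lambda>_. borel) (\<lambda>i \<omega>. emeasure (Z \<omega>) (A i)) UNIV"
    using prm unfolding poisson_random_measure_def by blast+
  interpret prob_space \<Omega> by (fact \<Omega>)
  have Zs: "sets (Z \<omega>) = sets m" if "\<omega> \<in> space \<Omega>" for \<omega>
    using measurable_space[OF Z that] by (simp add: space_measure_algebra)
  have Zem: "emeasure (distr (Z \<omega>) A' h) B = emeasure (Z \<omega>) (h -` B \<inter> space m)"
    if "\<omega> \<in> space \<Omega>" "B \<in> sets A'" for \<omega> B
  proof -
    have "h \<in> Z \<omega> \<rightarrow>\<^sub>M A'" using h Zs[OF that(1)] by (simp cong: measurable_cong_sets)
    then show ?thesis
      using that(2) sets_eq_imp_space_eq[OF Zs[OF that(1)]] by (simp add: emeasure_distr)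
  qed
  have pre: "h -` B \<inter> space m \<in> sets m" if "B \<in> sets A'" for B
    by (rule measurable_sets[OF h that])
  \<comment> \<open>Pushing the image back along \<open>k\<close> recovers \<open>m\<close>; a
    measure whose image is sigma-finite is itself sigma-finite.\<close>
  have "distr (distr m A' h) m k = distr m m (\<lambda>x. x)"
    using h k kh by (simp add: distr_distr comp_def cong: distr_cong)
  also have "\<dots> = m" by (rule distr_id)
  finally have "sigma_finite_measure (distr (distr m A' h) m k)" using sf by simp
  then have sf': "sigma_finite_measure (distr m A' h)"
    by (rule sigma_finite_measure_distr) (use k in simp)
  \<comment> \<open>The definition takes the target sigma-algebra from the intensity, so that of
    \<open>distr m A' h\<close> has to be identified with that of \<open>A'\<close>.\<close>
  have Z': "(\<lambda>\<omega>. distr (Z \<omega>) A' h) \<in> \<Omega> \<rightarrow>\<^sub>M measure_algebra (distr m A' h)"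
    using measurable_compose[OF Z measurable_distr_measure_algebra[OF h]]
    by (simp add: measure_algebra_cong[of "distr m A' h" A'])
  show ?thesis
    unfolding poisson_random_measure_def
  proof (intro conjI ballI impI allI \<Omega> sf' Z')
    fix B j assume "B \<in> sets (distr m A' h)" and fin: "emeasure (distr m A' h) B < \<infinity>"
    then have B: "B \<in> sets A'" by simp
    have "{\<omega> \<in> space \<Omega>. emeasure (distr (Z \<omega>) A' h) B = of_nat j} =
        {\<omega> \<in> space \<Omega>. emeasure (Z \<omega>) (h -` B \<inter> space m) = of_nat j}"
      using Zem[OF _ B] by auto
    then show "measure \<Omega> {\<omega> \<in> space \<Omega>. emeasure (distr (Z \<omega>) A' h) B = of_nat j} =
        measure (distr m A' h) B ^ j / fact j * exp (- measure (distr m A' h) B)"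
      using law[OF pre[OF B]] fin h B by (simp add: emeasure_distr measure_distr)
  next
    fix B assume "B \<in> sets (distr m A' h)" and top: "emeasure (distr m A' h) B = \<infinity>"
    then have B: "B \<in> sets A'" by simp
    have "AE \<omega> in \<Omega>. emeasure (Z \<omega>) (h -` B \<inter> space m) = \<infinity>"
      using inf[OF pre[OF B]] top h B by (simp add: emeasure_distr)
    then show "AE \<omega> in \<Omega>. emeasure (distr (Z \<omega>) A' h) B = \<infinity>"
      by (rule AE_mp) (auto simp: Zem[OF _ B])
  next
    fix B :: "nat \<Rightarrow> _ set"
    assume B: "range B \<subseteq> sets (distr m A' h) \<and> disjoint_family B"
    then have Bs: "B i \<in> sets A'" for i by auto
    have "disjoint_family (\<lambda>i. h -` B i \<inter> space m)"
      using B unfolding disjoint_family_on_def by blast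
    then have "indep_vars (\<lambda>_. borel) (\<lambda>i \<omega>. emeasure (Z \<omega>) (h -` B i \<inter> space m)) UNIV"
      using pre[OF Bs] by (intro ind) auto
    then show "indep_vars (\<lambda>_. borel) (\<lambda>i \<omega>. emeasure (distr (Z \<omega>) A' h) (B i)) UNIV"
      by (rule indep_vars_cong_space[THEN iffD1, rotated]) (simp add: Zem[OF _ Bs])
  qed
qed

section \<open>Transport along an equivariant homeomorphism\<close>

text \<open>The maps \<open>f\<close> and \<open>g\<close> act on atoms, \<open>h\<close> and
  \<open>k\<close> on the group parameters. The homeomorphism preserves the Radon property, and
  \<open>f_infinity_iff\<close> preserves the absence of mass at infinity.\<close>

locale equivariant_homeomorphism =
  fixes S S' :: "ereal set" and G G' :: "real set"
    and act act' :: "real \<Rightarrow> ereal \<Rightarrow> ereal"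
    and f g :: "ereal \<Rightarrow> ereal" and h k :: "real \<Rightarrow> real"
  assumes homeo: "homeomorphism S S' f g"
    and infinity_in: "\<infinity> \<in> S" "\<infinity> \<in> S'"
    and f_infinity_iff: "\<And>x. x \<in> S \<Longrightarrow> f x = \<infinity> \<longleftrightarrow> x = \<infinity>"
    and h_meas: "h \<in> restrict_space borel G \<rightarrow>\<^sub>M restrict_space borel G'"
    and k_meas: "k \<in> restrict_space borel G' \<rightarrow>\<^sub>M restrict_space borel G"
    and kh: "\<And>b. b \<in> G \<Longrightarrow> k (h b) = b"
    and act_meas: "\<And>b. b \<in> G \<Longrightarrow> act b \<in> Bor S \<rightarrow>\<^sub>M Bor S"
    and act'_meas: "\<And>b. b \<in> G' \<Longrightarrow> act' b \<in> Bor S' \<rightarrow>\<^sub>M Bor S'"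
    and equivariant: "\<And>b x. b \<in> G \<Longrightarrow> x \<in> S \<Longrightarrow> f (act b x) = act' (h b) (f x)"
begin

lemma f_meas: "f \<in> Bor S \<rightarrow>\<^sub>M Bor S'"
  using homeo
  by (intro measurable_restrict_space2 borel_measurable_continuous_on_restrict)
     (auto simp: homeomorphism_def space_restrict_space)

lemma h_in: "b \<in> G \<Longrightarrow> h b \<in> G'"
  using measurable_space[OF h_meas] by (simp add: space_restrict_space)

lemma map_atoms_measurable:
  "map_atoms S' f \<in> measure_algebra (Bor S) \<rightarrow>\<^sub>M measure_algebra (Bor S')"
  unfolding map_atoms_def by (rule measurable_distr_measure_algebra[OF f_meas])

text \<open>The preimage of a compact set under \<open>f\<close> is its image under the continuous
  inverse \<open>g\<close>, hence compact; the preimage of the point at infinity is that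
  point.\<close>

lemma map_atoms_point_measures:
  assumes "\<mu> \<in> point_measures S"
  shows "map_atoms S' f \<mu> \<in> point_measures S'"
proof -
  from assms obtain I u where u: "u \<in> I \<rightarrow> S" and \<mu>: "\<mu> = dirac_sum (Bor S) I u"
    and fin: "\<And>C. compact C \<Longrightarrow> C \<subseteq> S \<Longrightarrow> emeasure \<mu> C < \<infinity>" and zero: "emeasure \<mu> {\<infinity>} = 0"
    unfolding point_measures_def by blast
  have fS: "f ` S = S'" and gS: "g ` S' = S" and gf: "\<And>x. x \<in> S \<Longrightarrow> g (f x) = x"
    and fg: "\<And>y. y \<in> S' \<Longrightarrow> f (g y) = y" and g: "continuous_on S' g"
    using homeo by (auto simp: homeomorphism_def)
  have em: "emeasure (map_atoms S' f \<mu>) C = emeasure \<mu> (f -` C \<inter> S)" if "C \<in> sets (Bor S')" for C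
  proof -
    have "f \<in> \<mu> \<rightarrow>\<^sub>M Bor S'" using f_meas by (simp add: \<mu> dirac_sum_def cong: measurable_cong_sets)
    then show ?thesis
      using that by (simp add: map_atoms_def emeasure_distr) (simp add: \<mu> dirac_sum_def space_restrict_space)
  qed
  have "emeasure (map_atoms S' f \<mu>) C < \<infinity>" if C: "compact C" "C \<subseteq> S'" for C
  proof -
    \<comment> \<open>Compact sets are Borel in the extended reals; this equation exhibits
      \<open>C\<close> as the trace of a Borel set on \<open>S'\<close>.\<close>
    have "C = S' \<inter> C" using C by auto
    then have "C \<in> sets (Bor S')"
      using borel_compact[OF C(1)] unfolding sets_restrict_space by blast
    moreover have "f -` C \<inter> S = g ` C"
      using C(2) gf fg gS by (force simp: image_iff)
    moreover have "compact (g ` C)" "g ` C \<subseteq> S"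
      using compact_continuous_image[OF continuous_on_subset[OF g C(2)] C(1)] gS C(2) by auto
    ultimately show ?thesis
      using fin by (simp add: em)
  qed
  moreover have "emeasure (map_atoms S' f \<mu>) {\<infinity>} = 0"
  proof -
    have "{\<infinity>} \<in> sets (Bor S')"
      using infinity_in(2) unfolding sets_restrict_space by (auto intro!: image_eqI[of _ _ "{\<infinity>}"])
    moreover have "f -` {\<infinity>} \<inter> S = {\<infinity>}"
      using infinity_in(1) f_infinity_iff by auto
    ultimately show ?thesis using zero by (simp add: em)
  qed
  moreover have "map_atoms S' f \<mu> = dirac_sum (Bor S') I (\<lambda>i. f (u i))"
    unfolding \<mu> by (rule map_atoms_dirac_sum[OF u f_meas])
  moreover have "(\<lambda>i. f (u i)) \<in> I \<rightarrow> S'"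
    using u fS by auto
  ultimately show ?thesis
    unfolding point_measures_def by blast
qed

lemma map_atoms_point_process:
  assumes "point_process S \<Omega> N"
  shows "point_process S' \<Omega> (\<lambda>\<omega>. map_atoms S' f (N \<omega>))"
  using assms measurable_compose[OF _ map_atoms_measurable] map_atoms_point_measures
  unfolding point_process_def by blast

text \<open>Both sides are images of \<mu> under composed maps, and these agree on \<open>S\<close>
  by \<open>equivariant\<close>.\<close>

lemma map_atoms_equivariant:
  assumes b: "b \<in> G" and \<mu>: "sets \<mu> = sets (Bor S)"
  shows "map_atoms S' (act' (h b)) (map_atoms S' f \<mu>) = map_atoms S' f (map_atoms S (act b) \<mu>)"
proof -
  have f': "f \<in> \<mu> \<rightarrow>\<^sub>M Bor S'" and a: "act b \<in> \<mu> \<rightarrow>\<^sub>M Bor S"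
    using f_meas act_meas[OF b] \<mu> by (simp_all cong: measurable_cong_sets)
  have "map_atoms S' (act' (h b)) (map_atoms S' f \<mu>) = distr \<mu> (Bor S') (\<lambda>x. act' (h b) (f x))"
    using f' act'_meas[OF h_in[OF b]] by (simp add: map_atoms_def distr_distr comp_def)
  also have "\<dots> = distr \<mu> (Bor S') (\<lambda>x. f (act b x))"
    using sets_eq_imp_space_eq[OF \<mu>] equivariant[OF b]
    by (intro distr_cong) (auto simp: space_restrict_space)
  also have "\<dots> = map_atoms S' f (map_atoms S (act b) \<mu>)"
    using a f_meas by (simp add: map_atoms_def distr_distr comp_def)
  finally show ?thesis .
qed

section \<open>Transport of the decorated representation\<close>

lemma decorated_sum_transport:
  assumes W: "W \<omega> \<in> G" and lam: "\<And>i. lam i \<omega> \<in> G" and P: "\<And>i. sets (P i \<omega>) = sets (Bor S)"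
  shows "decorated_sum S' act' K (\<lambda>i \<omega>. h (lam i \<omega>)) (\<lambda>i \<omega>. map_atoms S' f (P i \<omega>)) (\<lambda>\<omega>. h (W \<omega>)) \<omega> =
    map_atoms S' f (decorated_sum S act K lam P W \<omega>)"
proof -
  let ?\<mu> = "\<lambda>i. map_atoms S (act (lam i \<omega>)) (P i \<omega>)"
  have "measure_sum (Bor S') (atom_index (K \<omega>)) (\<lambda>i. map_atoms S' f (?\<mu> i)) =
      map_atoms S' f (measure_sum (Bor S) (atom_index (K \<omega>)) ?\<mu>)"
    unfolding map_atoms_def by (rule distr_measure_sum[symmetric, OF _ f_meas]) simp
  then show ?thesis
    \<comment> \<open>Equivariance enters twice: for each decoration with parameter
      \<open>lam i \<omega>\<close>, and for the whole sum with parameter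
      \<open>W \<omega>\<close>.\<close>
    by (simp add: decorated_sum_def map_atoms_equivariant W lam P)
qed

text \<open>\<open>K\<close> is kept and every other ingredient is replaced by a measurable function
  of itself, so independence and equality in law survive; the new intensity is the image of the old
  one under \<open>h\<close>.\<close>

lemma decoration_data_transport:
  assumes "decoration_data S G \<Omega> K lam P W"
  shows "decoration_data S' G' \<Omega> K (\<lambda>i \<omega>. h (lam i \<omega>)) (\<lambda>i \<omega>. map_atoms S' f (P i \<omega>)) (\<lambda>\<omega>. h (W \<omega>))"
proof -
  define A where "A = restrict_space (borel :: real measure) G"
  define A' where "A' = restrict_space (borel :: real measure) G'"
  let ?MA = "\<lambda>S. measure_algebra (Bor S)"
  let ?aa = "\<lambda>A. count_space (UNIV :: enat set) \<Otimes>\<^sub>M (\<Pi>\<^sub>M i \<in> (UNIV :: nat set). A)"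
  let ?da = "\<lambda>S. \<Pi>\<^sub>M i \<in> (UNIV :: nat set). ?MA S"
  let ?at = "\<lambda>\<omega>. (K \<omega>, \<lambda>i. lam i \<omega>)"
  let ?de = "\<lambda>\<omega> i. P i \<omega>"
  let ?F = "map_atoms S' f"
  from assms obtain m where \<Omega>: "prob_space \<Omega>" and K: "K \<in> \<Omega> \<rightarrow>\<^sub>M count_space UNIV"
    and lam: "\<And>i. lam i \<in> \<Omega> \<rightarrow>\<^sub>M A" and W: "W \<in> \<Omega> \<rightarrow>\<^sub>M A" and m: "sets m = sets A"
    and prm: "poisson_random_measure \<Omega> m (\<lambda>\<omega>. dirac_sum A (atom_index (K \<omega>)) (\<lambda>i. lam i \<omega>))"
    and pp: "\<And>i. point_process S \<Omega> (P i)"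
    and eq: "\<And>i. eq_in_distr \<Omega> (P i) \<Omega> (P 0) (?MA S)"
    and ind: "prob_space.indep_vars \<Omega> (\<lambda>_. ?MA S) P UNIV"
    and ind1: "prob_space.indep_set \<Omega> (gen_sigma \<Omega> ?at (?aa A)) (gen_sigma \<Omega> ?de (?da S))"
    and ind2: "prob_space.indep_set \<Omega> (gen_sigma \<Omega> W A)
        (gen_sigma \<Omega> (\<lambda>\<omega>. (?at \<omega>, ?de \<omega>)) (?aa A \<Otimes>\<^sub>M ?da S))"
    unfolding decoration_data_def Let_def A_def[symmetric] by blast
  interpret prob_space \<Omega> by (fact \<Omega>)
  have h: "h \<in> A \<rightarrow>\<^sub>M A'" and k: "k \<in> A' \<rightarrow>\<^sub>M A"
    unfolding A_def A'_def by (fact h_meas k_meas)+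
  have P: "\<And>i. P i \<in> \<Omega> \<rightarrow>\<^sub>M ?MA S"
    using pp by (simp add: point_process_def)
  have F: "?F \<in> ?MA S \<rightarrow>\<^sub>M ?MA S'" by (rule map_atoms_measurable)
  have at: "?at \<in> \<Omega> \<rightarrow>\<^sub>M ?aa A"
    by (intro measurable_Pair K measurable_abs_UNIV lam)
  have de: "?de \<in> \<Omega> \<rightarrow>\<^sub>M ?da S"
    by (intro measurable_abs_UNIV P)
  \<comment> \<open>The three maps \<phi>, \<psi> and \<open>\<phi>\<psi>\<close> turn the old
    enumerated atoms, the old decorations and the pair of both into the new ones, as
    \<open>gen_sigma_compose_subset\<close> requires.\<close>
  have \<phi>: "(\<lambda>x. (fst x, \<lambda>i. h (snd x i))) \<in> ?aa A \<rightarrow>\<^sub>M ?aa A'"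
    by (intro measurable_Pair measurable_fst measurable_abs_UNIV measurable_compose[OF _ h]
        measurable_compose[OF measurable_snd measurable_component_singleton]) simp
  have \<psi>: "(\<lambda>p i. ?F (p i)) \<in> ?da S \<rightarrow>\<^sub>M ?da S'"
    by (intro measurable_abs_UNIV measurable_compose[OF _ F] measurable_component_singleton) simp
  have \<phi>\<psi>: "(\<lambda>y. ((fst (fst y), \<lambda>i. h (snd (fst y) i)), \<lambda>i. ?F (snd y i)))
      \<in> ?aa A \<Otimes>\<^sub>M ?da S \<rightarrow>\<^sub>M ?aa A' \<Otimes>\<^sub>M ?da S'"
    by (intro measurable_Pair measurable_compose[OF measurable_fst \<phi>] measurable_compose[OF measurable_snd \<psi>])
  have spm: "space m = G"
    using sets_eq_imp_space_eq[OF m] by (simp add: A_def space_restrict_space)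
  have lamG: "(\<lambda>i. lam i \<omega>) \<in> I \<rightarrow> space A" if "\<omega> \<in> space \<Omega>" for \<omega> I
    using measurable_space[OF lam that] by auto
  have "poisson_random_measure \<Omega> (distr m A' h)
      (\<lambda>\<omega>. distr (dirac_sum A (atom_index (K \<omega>)) (\<lambda>i. lam i \<omega>)) A' h)"
    using h k kh m spm
    by (intro poisson_random_measure_distr[OF prm, where k = k]) (simp_all cong: measurable_cong_sets)
  \<comment> \<open>The atoms are known to lie in \<open>G\<close> only at points of the sample
    space, hence the detour through \<open>poisson_random_measure_cong\<close>.\<close>
  moreover have "distr (dirac_sum A (atom_index (K \<omega>)) (\<lambda>i. lam i \<omega>)) A' h =
      dirac_sum A' (atom_index (K \<omega>)) (\<lambda>i. h (lam i \<omega>))" if "\<omega> \<in> space \<Omega>" for \<omega>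
    by (rule distr_dirac_sum[OF lamG[OF that] h])
  ultimately have prm': "poisson_random_measure \<Omega> (distr m A' h)
      (\<lambda>\<omega>. dirac_sum A' (atom_index (K \<omega>)) (\<lambda>i. h (lam i \<omega>)))"
    by (rule poisson_random_measure_cong)
  have ind': "indep_vars (\<lambda>_. ?MA S') (\<lambda>i \<omega>. ?F (P i \<omega>)) UNIV"
    by (rule indep_vars_compose2[OF ind F])
  have ind1': "indep_set (gen_sigma \<Omega> (\<lambda>\<omega>. (K \<omega>, \<lambda>i. h (lam i \<omega>))) (?aa A'))
      (gen_sigma \<Omega> (\<lambda>\<omega> i. ?F (P i \<omega>)) (?da S'))"
    using indep_set_mono[OF ind1 gen_sigma_compose_subset[OF at \<phi>] gen_sigma_compose_subset[OF de \<psi>]]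
    by simp
  have ind2': "indep_set (gen_sigma \<Omega> (\<lambda>\<omega>. h (W \<omega>)) A')
      (gen_sigma \<Omega> (\<lambda>\<omega>. ((K \<omega>, \<lambda>i. h (lam i \<omega>)), \<lambda>i. ?F (P i \<omega>))) (?aa A' \<Otimes>\<^sub>M ?da S'))"
    using indep_set_mono[OF ind2 gen_sigma_compose_subset[OF W h]
        gen_sigma_compose_subset[OF measurable_Pair[OF at de] \<phi>\<psi>]]
    by simp
  show ?thesis
    unfolding decoration_data_def Let_def A'_def[symmetric]
    using K measurable_compose[OF lam h] measurable_compose[OF W h] prm'
      map_atoms_point_process[OF pp] eq_in_distr_compose[OF eq F] ind' ind1' ind2' \<Omega>
    by (intro conjI allI exI[of _ "distr m A' h"]) simp_all
qed

theorem decorated_poisson_process_transport: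
  assumes "decorated_poisson_process S G act \<Omega> N"
  shows "decorated_poisson_process S' G' act' \<Omega> (\<lambda>\<omega>. map_atoms S' f (N \<omega>))"
proof -
  from assms obtain \<Omega>' :: "((enat \<times> (nat \<Rightarrow> real)) \<times> (nat \<Rightarrow> ereal measure) \<times> real) measure"
    and K lam P W where pp: "point_process S \<Omega> N" and dd: "decoration_data S G \<Omega>' K lam P W"
    and eq: "eq_in_distr \<Omega> N \<Omega>' (decorated_sum S act K lam P W) (measure_algebra (Bor S))"
    unfolding decorated_poisson_process_def by blast
  \<comment> \<open>The new representation lives on the same \<open>\<Omega>'\<close>, so the type
    fixed in the definition is respected.\<close>
  let ?D = "decorated_sum S' act' K (\<lambda>i \<omega>. h (lam i \<omega>)) (\<lambda>i \<omega>. map_atoms S' f (P i \<omega>)) (\<lambda>\<omega>. h (W \<omega>))"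
  have lam: "\<And>i. lam i \<in> \<Omega>' \<rightarrow>\<^sub>M restrict_space borel G" and W: "W \<in> \<Omega>' \<rightarrow>\<^sub>M restrict_space borel G"
    and P: "\<And>i. P i \<in> \<Omega>' \<rightarrow>\<^sub>M measure_algebra (Bor S)"
    using dd unfolding decoration_data_def Let_def point_process_def by blast+
  \<comment> \<open>Measurability of the data supplies the pointwise hypotheses: parameters in
    \<open>G\<close> and decorations with the sigma-algebra of \<open>Bor S\<close>.\<close>
  have "?D \<omega> = map_atoms S' f (decorated_sum S act K lam P W \<omega>)" if "\<omega> \<in> space \<Omega>'" for \<omega>
    using measurable_space[OF lam that] measurable_space[OF W that] measurable_space[OF P that]
    by (intro decorated_sum_transport) (simp_all add: space_restrict_space space_measure_algebra)
  then have "eq_in_distr \<Omega> (\<lambda>\<omega>. map_atoms S' f (N \<omega>)) \<Omega>' ?D (measure_algebra (Bor S'))"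
    using eq_in_distr_compose[OF eq map_atoms_measurable]
    by (simp add: eq_in_distr_def cong: measurable_cong distr_cong)
  then show ?thesis
    unfolding decorated_poisson_process_def
    using map_atoms_point_process[OF pp] decoration_data_transport[OF dd] by blast
qed

end

section \<open>Logarithm and exponential\<close>

lemma ereal_ln_simps [simp]: "ereal_ln (ereal r) = ereal (ln r)" "ereal_ln \<infinity> = \<infinity>"
  by (simp_all add: ereal_ln_def)

lemma ereal_exp_simps [simp]: "ereal_exp (ereal r) = ereal (exp r)" "ereal_exp \<infinity> = \<infinity>"
  by (simp_all add: ereal_exp_def)

lemma ereal_exp_ln: "x \<in> {0<..} \<Longrightarrow> ereal_exp (ereal_ln x) = x"
  by (cases x) auto

lemma ereal_ln_exp: "x \<in> {-\<infinity><..} \<Longrightarrow> ereal_ln (ereal_exp x) = x"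
  by (cases x) auto

lemma ereal_ln_image: "ereal_ln ` {0<..} = {-\<infinity><..}"
proof (intro equalityI subsetI)
  fix y :: ereal assume "y \<in> {-\<infinity><..}"
  then show "y \<in> ereal_ln ` {0<..}"
    by (intro image_eqI[of _ _ "ereal_exp y"]) (cases y; simp add: ereal_ln_exp)+
next
  fix y :: ereal assume "y \<in> ereal_ln ` {0<..}"
  then obtain x where "x \<in> {0<..}" "y = ereal_ln x" by blast
  then show "y \<in> {-\<infinity><..}" by (cases x) auto
qed

lemma ereal_exp_image: "ereal_exp ` {-\<infinity><..} = {0<..}"
  \<comment> \<open>The domain is rewritten as the image of \<open>ereal_ln\<close>, after which
    \<open>ereal_exp\<close> cancels it.\<close>
  by (simp flip: ereal_ln_image add: image_image ereal_exp_ln)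

text \<open>Continuity comes from order alone: a monotone map with open image is continuous, and
  both images are open rays.\<close>

lemma ereal_ln_homeomorphism: "homeomorphism {0<..} {-\<infinity><..} ereal_ln ereal_exp"
proof -
  have "continuous_on {0<..} ereal_ln"
  proof (rule continuous_onI_mono)
    fix x y :: ereal assume "x \<in> {0<..}" "y \<in> {0<..}" "x \<le> y"
    then show "ereal_ln x \<le> ereal_ln y" by (cases x; cases y) auto
  qed (simp add: ereal_ln_image)
  moreover have "continuous_on {-\<infinity><..} ereal_exp"
  proof (rule continuous_onI_mono)
    fix x y :: ereal assume "x \<in> {-\<infinity><..}" "y \<in> {-\<infinity><..}" "x \<le> y"
    then show "ereal_exp x \<le> ereal_exp y" by (cases x; cases y) auto
  qed (simp add: ereal_exp_image)
  ultimately show ?thesis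
    by (simp add: homeomorphism_def ereal_ln_image ereal_exp_image ereal_exp_ln ereal_ln_exp)
qed

lemma ln_measurable_pos: "ln \<in> restrict_space borel {0::real<..} \<rightarrow>\<^sub>M restrict_space borel UNIV"
  by (intro measurable_restrict_space2 measurable_restrict_space1) auto

lemma exp_measurable_pos: "exp \<in> restrict_space borel UNIV \<rightarrow>\<^sub>M restrict_space borel {0::real<..}"
  by (intro measurable_restrict_space2 measurable_restrict_space1) auto

lemma scaling_measurable:
  assumes "b \<in> {0<..}"
  shows "(\<lambda>x. ereal b * x) \<in> Bor {0<..} \<rightarrow>\<^sub>M Bor {0<..}"
  using assms
  by (intro measurable_restrict_space2 measurable_restrict_space1)
     (auto simp: space_restrict_space ereal_zero_less_0_iff)

lemma translation_measurable: "(\<lambda>x. ereal b + x) \<in> Bor {-\<infinity><..} \<rightarrow>\<^sub>M Bor {-\<infinity><..}"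
proof (intro measurable_restrict_space2 measurable_restrict_space1)
  show "(\<lambda>x. ereal b + x) \<in> space (Bor {-\<infinity><..}) \<rightarrow> {-\<infinity><..}"
  proof
    fix x assume "x \<in> space (Bor {-\<infinity><..})"
    then show "ereal b + x \<in> {-\<infinity><..}" by (cases x) (auto simp: space_restrict_space)
  qed
qed simp

section \<open>The two instances\<close>

interpretation ln: equivariant_homeomorphism "{0<..}" "{-\<infinity><..}" "{0<..}" UNIV
  "\<lambda>b x. ereal b * x" "\<lambda>b x. ereal b + x" ereal_ln ereal_exp ln exp
proof unfold_locales
  fix x :: ereal assume x: "x \<in> {0<..}"
  then show "ereal_ln x = \<infinity> \<longleftrightarrow> x = \<infinity>" by (cases x) auto
  fix b :: real assume "b \<in> {0<..}"
  then show "ereal_ln (ereal b * x) = ereal (ln b) + ereal_ln x"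
    \<comment> \<open>For finite \<open>x\<close> this is the logarithm of a product; at infinity
      both sides are infinite because \<open>b\<close> is positive.\<close>
    using x by (cases x) (auto simp: ln_mult)
qed (auto intro: ereal_ln_homeomorphism ln_measurable_pos exp_measurable_pos scaling_measurable
    translation_measurable)

text \<open>The instance with all roles exchanged; it yields the converse direction, since the
  locale transports only from \<open>S\<close> to \<open>S'\<close>.\<close>

interpretation exp: equivariant_homeomorphism "{-\<infinity><..}" "{0<..}" UNIV "{0<..}"
  "\<lambda>b x. ereal b + x" "\<lambda>b x. ereal b * x" ereal_exp ereal_ln exp ln
proof unfold_locales
  show "homeomorphism {-\<infinity><..} {0<..} ereal_exp ereal_ln"
    using ereal_ln_homeomorphism by (simp add: homeomorphism_symD)
  fix x :: ereal assume x: "x \<in> {-\<infinity><..}"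
  then show "ereal_exp x = \<infinity> \<longleftrightarrow> x = \<infinity>" by (cases x) auto
  fix b :: real
  show "ereal_exp (ereal b + x) = ereal (exp b) * ereal_exp x"
    \<comment> \<open>At infinity the right-hand side is infinite because \<open>exp b\<close> is
      positive.\<close>
    using x by (cases x) (auto simp: exp_add)
qed (auto intro: ln_measurable_pos exp_measurable_pos scaling_measurable translation_measurable)

theorem mainTheorem4:
  fixes \<Omega>\<^sub>1 :: "'a measure" and N :: "'a \<Rightarrow> ereal measure"
    and \<Omega>\<^sub>2 :: "'b measure" and T :: "'b \<Rightarrow> ereal measure"
  shows "(SScDPPP \<Omega>\<^sub>1 N \<longrightarrow> SDPPP \<Omega>\<^sub>1 (\<lambda>\<omega>. log_atoms (N \<omega>))) \<and>
         (SDPPP \<Omega>\<^sub>2 T \<longrightarrow> SScDPPP \<Omega>\<^sub>2 (\<lambda>\<omega>. exp_atoms (T \<omega>)))"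
  unfolding SScDPPP_def SDPPP_def log_atoms_def exp_atoms_def
  using ln.decorated_poisson_process_transport exp.decorated_poisson_process_transport by blast

end
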